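(* Let $K$ be a field of characteristic $\neq2$, let $f\in K[t]$ be a polynomial of degree $2g+2$ with no multiple roots, and let $f=f^{(1)}f^{(2)}$ be a factorization into two polynomials in $K[t]$ of degree $g+1$. Let $a,b,c,d\in K[t]$, not all zero, and let $k=\max\{\deg a,\ g+1+\deg b,\ \deg c,\ g+1+\deg d\}$. Suppose $k\le12$. Then the functions $a+b\sqrt f$ and $c+d\sqrt f$ have a common zero if and only if the determinant of the $2k\times2k$ matrix $$A=\begin{pmatrix} A^{11} & A^{12} \\ A^{21} & A^{22} \end{pmatrix}$$ vanishes, where the $k\times k$ blocks are given, for $1\le i,j\le k$, by $$A^{11}_{i,j}=\sum_{\substack{0\le p<q\le k\\ p<\min(i,j),\ p+q=i+j-1}}\bigl([p^{(2)},q]+[p,q^{(2)}]\bigr),$$ $$A^{12}_{i,j}=\sum_{\substack{0\le p<q\le k\\ p<\min(i,j),\ p+q=i+j-1}}[p,q]\;+\sum_{\substack{0\le p,q\le k\\ p<j,\ p+q=i+j-1}}[p^{(1)},q^{(2)}],$$ $$A^{21}_{i,j}=\sum_{\substack{0\le p<q\le k\\ p<\min(i,j),\ p+q=i+j-1}}[p,q]\;+\sum_{\substack{0\le p,q\le k\\ p<j,\ p+q=i+j-1}}[p^{(2)},q^{(1)}],$$ $$A^{22}_{i,j}=\sum_{\substack{0\le p<q\le k\\ p<\min(i,j),\ p+q=i+j-1}}\bigl([p^{(1)},q]+[p,q^{(1)}]\bigr).$$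
   Context: For a polynomial $r$ write $(r)_p$ for its coefficient of $t^p$; the degree of the zero polynomial is $-\infty$. Consider the $2\times3(k+1)$ matrix $$\begin{pmatrix}a_0&\cdots&a_k&(bf^{(1)})_0&\cdots&(bf^{(1)})_k&(bf^{(2)})_0&\cdots&(bf^{(2)})_k\\ c_0&\cdots&c_k&(df^{(1)})_0&\cdots&(df^{(1)})_k&(df^{(2)})_0&\cdots&(df^{(2)})_k\end{pmatrix}.$$ For $0\le p\le k$, the symbol $p$ refers to the column $(a_p,c_p)^t$, the symbol $p^{(1)}$ to the column $((bf^{(1)})_p,(df^{(1)})_p)^t$, and $p^{(2)}$ to the column $((bf^{(2)})_p,(df^{(2)})_p)^t$. A bracket $[x,y]$ of two such symbols denotes the $2\times2$ minor whose first column is that of $x$ and second column that of $y$. Let $C$ be the smooth projective (hyperelliptic) curve with function field $K(t)[\sqrt f]$ and $\pi:C\to\mathbf P^1$ the double cover given by $K(t)\subset K(t)[\sqrt f]$. The functions $1,t,\dots,t^k,\sqrt f,t\sqrt f,\dots,t^{k-g-1}\sqrt f$ are regarded as global sections of $\mathcal O_C(H)=\pi^*\mathcal O_{\mathbf P^1}(k)$; "common zero" means a common zero of $a+b\sqrt f$ and $c+d\sqrt f$, regarded as sections of $\mathcal O_C(H)$, at a point of $C$ over an algebraic closure of $K$ (points over $t=\infty$ included). *)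

theory Defs
  imports
    "HOL-Algebra.Algebraic_Closure_Type"
    "Jordan_Normal_Form.Determinant"
begin

hide_const (open) UnivPoly.coeff UnivPoly.monom Polynomials.degree

section \<open>The hyperelliptic curve\<close>

definition homogenize :: "nat \<Rightarrow> 'a::field poly \<Rightarrow> 'a \<Rightarrow> 'a \<Rightarrow> 'a" where
  "homogenize n p x0 x1 = (\<Sum>i\<le>n. coeff p i * x0 ^ (n - i) * x1 ^ i)"

text \<open>
  The smooth projective curve with function field generated by \<open>t\<close> and \<open>sqrt f\<close>, where \<open>f\<close> has
  degree \<open>2g+2\<close> and no multiple roots, is the hypersurface \<open>y^2 = F(x0,x1)\<close> in the weighted
  projective plane \<open>P(1,1,g+1)\<close>, with \<open>F\<close> the form of degree \<open>2g+2\<close> attached to \<open>f\<close>;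
  here \<open>t = x1/x0\<close>, \<open>sqrt f = y/x0^(g+1)\<close>, and the double cover is \<open>[x0:x1:y] \<mapsto> [x0:x1]\<close>.
  The points over \<open>t = \<infinity>\<close> are those with \<open>x0 = 0\<close>.  No point of this hypersurface
  has \<open>x0 = x1 = 0\<close>.
\<close>

definition curve_cone :: "nat \<Rightarrow> 'a::field poly \<Rightarrow> ('a \<times> 'a \<times> 'a) set" where
  "curve_cone g f =
     {(x0, x1, y). (x0, x1) \<noteq> (0, 0) \<and> y\<^sup>2 = homogenize (2 * g + 2) f x0 x1}"

definition weighted_rel ::
    "nat \<Rightarrow> 'a::field poly \<Rightarrow> (('a \<times> 'a \<times> 'a) \<times> ('a \<times> 'a \<times> 'a)) set" where
  "weighted_rel g f =
     {((x0, x1, y), (x0', x1', y')). (x0, x1, y) \<in> curve_cone g f \<and>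
        (\<exists>l. l \<noteq> 0 \<and> x0' = l * x0 \<and> x1' = l * x1 \<and> y' = l ^ (g + 1) * y)}"

definition hyperelliptic_curve :: "nat \<Rightarrow> 'a::field poly \<Rightarrow> ('a \<times> 'a \<times> 'a) set set" where
  "hyperelliptic_curve g f = curve_cone g f // weighted_rel g f"

text \<open>
  The function \<open>a + b sqrt f\<close> as a section of the pullback of \<open>O(k)\<close> is the weighted form
  \<open>x0^k (a + b sqrt f)\<close> of degree \<open>k\<close>, for \<open>deg a \<le> k\<close> and \<open>g + 1 + deg b \<le> k\<close>
  (if \<open>k < g + 1\<close>, the latter says \<open>b = 0\<close>, and the second summand is \<open>0\<close>).
\<close>

definition section_form ::
    "nat \<Rightarrow> nat \<Rightarrow> 'a::field poly \<Rightarrow> 'a poly \<Rightarrow> 'a \<times> 'a \<times> 'a \<Rightarrow> 'a" where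
  "section_form g k a b = (\<lambda>(x0, x1, y).
     homogenize k a x0 x1 + homogenize (k - (g + 1)) b x0 x1 * y)"

definition section_vanishes_at ::
    "nat \<Rightarrow> nat \<Rightarrow> 'a::field poly \<Rightarrow> 'a poly \<Rightarrow> ('a \<times> 'a \<times> 'a) set \<Rightarrow> bool" where
  "section_vanishes_at g k a b P \<longleftrightarrow> (\<forall>v\<in>P. section_form g k a b v = 0)"

definition have_common_zero ::
    "nat \<Rightarrow> 'a::field poly \<Rightarrow> nat \<Rightarrow> 'a poly \<Rightarrow> 'a poly \<Rightarrow> 'a poly \<Rightarrow> 'a poly \<Rightarrow> bool" where
  "have_common_zero g f k a b c d \<longleftrightarrow>
     (\<exists>P \<in> hyperelliptic_curve g (map_poly to_ac f).
        section_vanishes_at g k (map_poly to_ac a) (map_poly to_ac b) P \<and>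
        section_vanishes_at g k (map_poly to_ac c) (map_poly to_ac d) P)"


subsection \<open>The weighted model is well defined and smooth\<close>

lemma homogenize_scale: "homogenize n p (l * x0) (l * x1) = l ^ n * homogenize n p x0 x1"
  unfolding homogenize_def sum_distrib_left
proof (rule sum.cong [OF refl])
  fix i assume "i \<in> {..n}"
  then have "l ^ n = l ^ (n - i) * l ^ i"
    by (simp flip: power_add)
  then show "coeff p i * (l * x0) ^ (n - i) * (l * x1) ^ i
      = l ^ n * (coeff p i * x0 ^ (n - i) * x1 ^ i)"
    by (simp add: power_mult_distrib)
qed

lemma homogenize_one: "degree p \<le> n \<Longrightarrow> homogenize n p 1 x = poly p x"
  unfolding homogenize_def poly_altdef
  by (rule sum.mono_neutral_cong_right) (auto simp: coeff_eq_0)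

lemma homogenize_infinity: "homogenize n p 0 1 = coeff p n"
proof -
  have "homogenize n p 0 1 = (\<Sum>i\<le>n. if i = n then coeff p i else 0)"
    unfolding homogenize_def by (rule sum.cong) (auto simp: power_0_left)
  then show ?thesis by simp
qed

lemma section_form_scale:
  assumes "b = 0 \<or> g + 1 \<le> k"
  shows "section_form g k a b (l * x0, l * x1, l ^ (g + 1) * y)
      = l ^ k * section_form g k a b (x0, x1, y)"
proof (cases "b = 0")
  case True
  then show ?thesis
    by (simp add: section_form_def homogenize_scale) (simp add: homogenize_def)
next
  case False
  with assms have "l ^ k = l ^ (k - (g + 1)) * l ^ (g + 1)"
    by (metis le_add_diff_inverse2 power_add)
  then show ?thesis
    by (simp add: section_form_def homogenize_scale algebra_simps)
qed

lemma equiv_weighted_rel: "equiv (curve_cone g f) (weighted_rel g f)"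
proof (rule equivI)
  have cone: "(l * x0, l * x1, l ^ (g + 1) * y) \<in> curve_cone g f"
    if "(x0, x1, y) \<in> curve_cone g f" "l \<noteq> 0" for l x0 x1 y
  proof -
    have "(l ^ (g + 1))\<^sup>2 = l ^ (2 * g + 2)"
      by (simp only: power_mult [symmetric]) (simp add: algebra_simps)
    with that show ?thesis
      by (simp only: curve_cone_def mem_Collect_eq prod.case homogenize_scale power_mult_distrib)
        simp
  qed
  show "weighted_rel g f \<subseteq> curve_cone g f \<times> curve_cone g f"
    using cone by (auto simp: weighted_rel_def)
  show "refl_on (curve_cone g f) (weighted_rel g f)"
    by (auto simp: refl_on_def weighted_rel_def intro: exI[of _ 1])
  show "sym (weighted_rel g f)"
  proof (rule symI)
    fix v w assume "(v, w) \<in> weighted_rel g f"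
    then obtain x0 x1 y l where *: "v = (x0, x1, y)" "v \<in> curve_cone g f" "l \<noteq> 0"
        "w = (l * x0, l * x1, l ^ (g + 1) * y)"
      by (auto simp: weighted_rel_def)
    have "\<exists>m. m \<noteq> 0 \<and> x0 = m * (l * x0) \<and> x1 = m * (l * x1) \<and>
        y = m ^ (g + 1) * (l ^ (g + 1) * y)"
      using \<open>l \<noteq> 0\<close>
      by (intro exI[of _ "inverse l"])
        (simp add: power_inverse field_simps del: power_Suc)
    with * cone show "(w, v) \<in> weighted_rel g f"
      by (auto simp: weighted_rel_def)
  qed
  show "trans (weighted_rel g f)"
  proof (rule transI)
    fix u v w assume "(u, v) \<in> weighted_rel g f" "(v, w) \<in> weighted_rel g f"
    then obtain x0 x1 y l m where *: "u = (x0, x1, y)" "u \<in> curve_cone g f" "l \<noteq> 0" "m \<noteq> 0"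
        "w = (m * (l * x0), m * (l * x1), m ^ (g + 1) * (l ^ (g + 1) * y))"
      by (auto simp: weighted_rel_def)
    then show "(u, w) \<in> weighted_rel g f"
      by (auto simp: weighted_rel_def power_mult_distrib mult.assoc intro!: exI[of _ "m * l"])
  qed
qed

text \<open>Jacobian criterion in the chart \<open>x0 = 1\<close>, which is the plane curve \<open>y^2 = f(x)\<close>.\<close>

lemma smooth_affine_chart:
  fixes f :: "'a::field poly"
  assumes "(2::'a) \<noteq> 0" "degree f = 2 * g + 2" "rsquarefree f" "(1, x, y) \<in> curve_cone g f"
  shows "\<not> (2 * y = 0 \<and> poly (pderiv f) x = 0)"
proof
  assume *: "2 * y = 0 \<and> poly (pderiv f) x = 0"
  have "y\<^sup>2 = poly f x"
    using assms by (simp add: curve_cone_def homogenize_one)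
  with * assms(1) have root: "poly f x = 0" by auto
  then obtain h where h: "f = [:-x, 1:] * h"
    by (auto simp: poly_eq_0_iff_dvd)
  with * have "poly h x = 0"
    by (simp add: pderiv_mult pderiv_pCons del: mult_pCons_left)
  then have "[:-x, 1:] ^ 2 dvd f"
    unfolding h power2_eq_square by (intro mult_dvd_mono) (auto simp: poly_eq_0_iff_dvd)
  moreover have "f \<noteq> 0" "order x f \<le> 1"
    using assms(3) by (auto simp: rsquarefree_def) (metis le_refl zero_le)
  ultimately show False
    by (metis order_divides numeral_le_one_iff order.trans semiring_norm(69))
qed

text \<open>At the points with \<open>x0 = 0\<close>, in the chart \<open>x1 = 1\<close>, the derivative of the equation with
  respect to \<open>y\<close> does not vanish.\<close>

lemma smooth_at_infinity:
  fixes f :: "'a::field poly"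
  assumes "(2::'a) \<noteq> 0" "degree f = 2 * g + 2" "(0, 1, y) \<in> curve_cone g f"
  shows "2 * y \<noteq> 0"
proof -
  have "y\<^sup>2 = coeff f (degree f)"
    using assms by (simp add: curve_cone_def homogenize_infinity)
  moreover have "f \<noteq> 0" using assms(2) by auto
  ultimately show ?thesis
    using assms(1) by auto
qed


section \<open>The resultant matrix\<close>

definition col2 :: "'a::field poly \<Rightarrow> 'a poly \<Rightarrow> nat \<Rightarrow> 'a \<times> 'a" where
  "col2 r s p = (coeff r p, coeff s p)"

definition minor2 :: "'a::field \<times> 'a \<Rightarrow> 'a \<times> 'a \<Rightarrow> 'a" where
  "minor2 x y = fst x * snd y - fst y * snd x"

definition sum_lt :: "nat \<Rightarrow> nat \<Rightarrow> nat \<Rightarrow> (nat \<Rightarrow> nat \<Rightarrow> 'a::field) \<Rightarrow> 'a" where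
  "sum_lt k i j h =
     (\<Sum>(p, q) \<in> {(p, q). p < q \<and> q \<le> k \<and> p < min i j \<and> p + q = i + j - 1}. h p q)"

definition sum_all :: "nat \<Rightarrow> nat \<Rightarrow> nat \<Rightarrow> (nat \<Rightarrow> nat \<Rightarrow> 'a::field) \<Rightarrow> 'a" where
  "sum_all k i j h =
     (\<Sum>(p, q) \<in> {(p, q). p \<le> k \<and> q \<le> k \<and> p < j \<and> p + q = i + j - 1}. h p q)"

text \<open>Matrix entries are indexed from \<open>0\<close> in the library; the entry formulas below use indices
  from \<open>1\<close>.\<close>

definition mat_from_1 :: "nat \<Rightarrow> (nat \<Rightarrow> nat \<Rightarrow> 'a) \<Rightarrow> 'a mat" where
  "mat_from_1 k e = mat k k (\<lambda>(i, j). e (i + 1) (j + 1))"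

definition resultant_matrix ::
    "nat \<Rightarrow> 'a::field poly \<Rightarrow> 'a poly \<Rightarrow> 'a poly \<Rightarrow> 'a poly \<Rightarrow> 'a poly \<Rightarrow> 'a poly \<Rightarrow> 'a mat" where
  "resultant_matrix k f1 f2 a b c d =
     (let u = col2 a c;
          u1 = col2 (b * f1) (d * f1);
          u2 = col2 (b * f2) (d * f2)
      in four_block_mat
        (mat_from_1 k (\<lambda>i j.
           sum_lt k i j (\<lambda>p q. minor2 (u2 p) (u q) + minor2 (u p) (u2 q))))
        (mat_from_1 k (\<lambda>i j.
           sum_lt k i j (\<lambda>p q. minor2 (u p) (u q)) + sum_all k i j (\<lambda>p q. minor2 (u1 p) (u2 q))))
        (mat_from_1 k (\<lambda>i j.
           sum_lt k i j (\<lambda>p q. minor2 (u p) (u q)) + sum_all k i j (\<lambda>p q. minor2 (u2 p) (u1 q))))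
        (mat_from_1 k (\<lambda>i j.
           sum_lt k i j (\<lambda>p q. minor2 (u1 p) (u q) + minor2 (u p) (u1 q)))))"

end

theory Submission
  imports Defs
begin

text \<open>
  Multiplication by \<open>sqrt f\<close> is realised on \<open>K[t]^2\<close> by the matrix with rows \<open>(0, f1)\<close> and \<open>(f2, 0)\<close>,
  so \<open>a + b sqrt f\<close> and \<open>c + d sqrt f\<close> become commuting matrix polynomials \<open>P\<close> and \<open>Q\<close> of degree
  at most \<open>k\<close>. A common zero at \<open>t\<close> is a common kernel vector of \<open>P(t)\<close> and \<open>Q(t)\<close> (of the
  coefficients of \<open>t^k\<close> if \<open>t = \<infinity>\<close>). The matrix in question is the block Bezoutian of \<open>P\<close> and
  \<open>Q\<close>, that is, the coefficients of \<open>(Q(t) P(s) - P(t) Q(s)) / (t - s)\<close>: because \<open>P\<close> and \<open>Q\<close> commute,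
  it maps a vector \<open>w\<close> to the coefficients of \<open>P V - Q U\<close>, where \<open>U\<close> and \<open>V\<close> combine the shifts
  of \<open>P\<close> and \<open>Q\<close> with weights \<open>w\<close> and have degree less than \<open>k\<close>.

  A common kernel vector \<open>v\<close> at \<open>t\<close> gives the null vector with entries \<open>t^j v\<close> (at infinity: only the
  last entry is \<open>v\<close>). Conversely, without common zeros \<open>P V = Q U\<close> forces \<open>U = P z\<close> and \<open>V = Q z\<close> for
  a polynomial vector \<open>z\<close>; the absence of common zeros at infinity gives \<open>z = 0\<close> by comparing
  degrees, and then \<open>w = 0\<close> from the top coefficients of \<open>U\<close> and \<open>V\<close>.
\<close>

section \<open>The block Bezoutian\<close>

text \<open>One half of a Bezoutian column: \<open>bez_col n u v - bez_col n v u\<close> is the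
  coefficient of \<open>s^(n-1)\<close> in \<open>(u(s) v(t) - v(s) u(t)) / (t - s)\<close>. The
  halves are kept apart because the off-diagonal blocks pair \<open>b1\<close> with
  \<open>d2\<close> but \<open>d1\<close> with \<open>b2\<close>.\<close>

definition bez_col :: "nat \<Rightarrow> 'a::comm_ring_1 poly \<Rightarrow> 'a poly \<Rightarrow> 'a poly" where
  "bez_col n u v = (\<Sum>p<n. smult (coeff u p) (poly_shift (n - p) v))"

lemma poly_shift_add: "poly_shift n (p + q) = poly_shift n p + poly_shift n (q :: 'a::comm_ring_1 poly)"
  by (simp add: poly_eq_iff coeff_poly_shift)

lemma poly_shift_smult: "poly_shift n (smult c p) = smult c (poly_shift n (p :: 'a::comm_ring_1 poly))"
  by (simp add: poly_eq_iff coeff_poly_shift)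

lemma poly_shift_Suc_pCons: "poly_shift (Suc n) (pCons c p) = poly_shift n p"
  by (simp add: poly_eq_iff coeff_poly_shift)

text \<open>In the block entries the first terms cancel, because the matrix polynomials commute.\<close>

lemma bez_col_eq: "bez_col n u v = poly_shift n (u * v) - poly_shift n u * v"
proof (induction u arbitrary: n)
  case 0
  show ?case by (simp add: bez_col_def)
next
  case (pCons c u)
  show ?case
  proof (cases n)
    case 0
    then show ?thesis by (simp add: bez_col_def)
  next
    case (Suc m)
    have "bez_col n (pCons c u) v = smult c (poly_shift n v) + bez_col m u v"
      unfolding Suc bez_col_def by (subst sum.lessThan_Suc_shift) simp
    then show ?thesis
      by (simp add: pCons.IH Suc poly_shift_add poly_shift_smult poly_shift_Suc_pCons)
  qed
qed

section \<open>Entry sums as polynomial coefficients\<close>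

lemma coeff_bez_col: "coeff (bez_col n u v) i = (\<Sum>p<n. coeff u p * coeff v (i + n - p))"
  unfolding bez_col_def coeff_sum coeff_smult coeff_poly_shift
  by (rule sum.cong) auto

lemma coeff_bez_col_eq_0: "degree v \<le> k \<Longrightarrow> k \<le> i \<Longrightarrow> coeff (bez_col n u v) i = 0"
  unfolding coeff_bez_col by (intro sum.neutral) (auto simp: coeff_eq_0)

text \<open>The bound \<open>q \<le> k\<close> drops only zero coefficients of \<open>v\<close>, and
  \<open>p \<le> k\<close> follows from \<open>p < j\<close>. \<open>Suc i\<close> is the row index
  counted from 1.\<close>

lemma sum_all_eq_coeff_bez_col:
  fixes u v :: "'a::field poly"
  assumes "degree v \<le> k" "j \<le> k"
  shows "sum_all k (Suc i) j (\<lambda>p q. coeff u p * coeff v q) = coeff (bez_col j u v) i"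
proof -
  let ?S = "{(p, q). p \<le> k \<and> q \<le> k \<and> p < j \<and> p + q = Suc i + j - 1}"
  have "(\<Sum>p<j. coeff u p * coeff v (i + j - p))
      = (\<Sum>p\<in>{p. p < j \<and> i + j - p \<le> k}. coeff u p * coeff v (i + j - p))"
    using assms(1) by (intro sum.mono_neutral_right) (auto intro: order.trans[OF le_degree])
  also have "\<dots> = (\<Sum>(p, q)\<in>?S. coeff u p * coeff v q)"
    using assms(2)
    by (intro sum.reindex_bij_witness[where i = fst and j = "\<lambda>p. (p, i + j - p)"]) auto
  finally show ?thesis
    by (simp add: sum_all_def coeff_bez_col)
qed

text \<open>Pairs with \<open>p < i\<close> have \<open>q \<ge> j > p\<close> and make up
  \<open>sum_lt\<close>. The others satisfy \<open>i \<le> p < j\<close>, hence also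
  \<open>i \<le> q < j\<close>, so exchanging \<open>p\<close> and \<open>q\<close> permutes them
  and their sum cancels. \<open>diag\<close> is assumed separately, since antisymmetry does not give
  it in characteristic 2.\<close>

lemma sum_lt_eq_sum_all:
  fixes h :: "nat \<Rightarrow> nat \<Rightarrow> 'a::field"
  assumes anti: "\<And>p q. h p q = - h q p" and diag: "\<And>p. h p p = 0"
    and "i \<le> k" "j \<le> k"
  shows "sum_lt k i j h = sum_all k i j h"
proof -
  let ?T = "{(p, q). p < q \<and> q \<le> k \<and> p < min i j \<and> p + q = i + j - 1}"
  let ?L = "{(p, q). i \<le> p \<and> p < q \<and> p < j \<and> p + q = i + j - 1}"
  let ?D = "{(p, q). i \<le> p \<and> p = q \<and> p < j \<and> p + q = i + j - 1}"
  let ?G = "{(p, q). i \<le> p \<and> q < p \<and> p < j \<and> p + q = i + j - 1}"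
  have fin: "finite B" if "B \<subseteq> {..i + j} \<times> {..i + j}" for B
    using that by (rule finite_subset) simp
  have fins: "finite ?T" "finite ?L" "finite ?D" "finite ?G"
    by (auto intro!: fin)
  have "{(p, q). p \<le> k \<and> q \<le> k \<and> p < j \<and> p + q = i + j - 1} = ?T \<union> (?L \<union> (?D \<union> ?G))"
    using assms(3,4) by auto
  then have "sum_all k i j h = (\<Sum>(p, q)\<in>?T \<union> (?L \<union> (?D \<union> ?G)). h p q)"
    by (simp add: sum_all_def)
  also have "\<dots> = (\<Sum>(p, q)\<in>?T. h p q) + ((\<Sum>(p, q)\<in>?L. h p q)
      + ((\<Sum>(p, q)\<in>?D. h p q) + (\<Sum>(p, q)\<in>?G. h p q)))"
    using fins by (subst sum.union_disjoint, simp, simp, force)+ simp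
  also have "(\<Sum>(p, q)\<in>?D. h p q) = 0"
    by (intro sum.neutral) (auto simp: diag)
  also have "(\<Sum>(p, q)\<in>?G. h p q) = (\<Sum>(p, q)\<in>?L. - h p q)"
    by (intro sum.reindex_bij_witness[where i = "\<lambda>(p, q). (q, p)" and j = "\<lambda>(p, q). (q, p)"])
      (auto intro: anti[symmetric])
  finally show ?thesis
    by (simp add: sum_lt_def sum_negf case_prod_unfold)
qed

lemma sum_all_add: "sum_all k i j (\<lambda>p q. h p q + h' p q) = sum_all k i j h + sum_all k i j h'"
  by (simp add: sum_all_def sum.distrib case_prod_unfold)

lemma sum_all_diff: "sum_all k i j (\<lambda>p q. h p q - h' p q) = sum_all k i j h - sum_all k i j h'"
  by (simp add: sum_all_def sum_subtractf case_prod_unfold)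

lemma sum_all_minor2:
  assumes "degree u \<le> k" "degree u' \<le> k" "degree v \<le> k" "degree v' \<le> k" "j \<le> k"
  shows "sum_all k (Suc i) j (\<lambda>p q. minor2 (col2 u v p) (col2 u' v' q))
    = coeff (bez_col j u v' - bez_col j v u') i"
  using assms
  by (simp add: minor2_def col2_def sum_all_diff sum_all_eq_coeff_bez_col
      mult.commute[of "coeff u' _" "coeff v _"])

text \<open>For \<open>degree u \<le> k\<close> and weights \<open>x j = s ^ j\<close> this is the
  divided difference \<open>(u(t) - u(s)) / (t - s)\<close>.\<close>

definition shift_comb :: "nat \<Rightarrow> 'a::comm_ring_1 poly \<Rightarrow> (nat \<Rightarrow> 'a) \<Rightarrow> 'a poly" where
  "shift_comb k u x = (\<Sum>j<k. smult (x j) (poly_shift (Suc j) u))"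

text \<open>\<open>W2\<close> and \<open>W1\<close> are the first and second components of
  \<open>P V - Q U\<close>, so the block rows appear in swapped order. By \<open>bez_col_eq\<close>
  the weighted columns add up to these products. Since nothing survives from degree \<open>k\<close>
  on, the product vector records all of \<open>W1\<close> and \<open>W2\<close>.\<close>

lemma resultant_matrix_mult_vec:
  fixes a b c d f1 f2 :: "'a::field poly" and x y :: "nat \<Rightarrow> 'a"
  defines "b1 \<equiv> b * f1" and "b2 \<equiv> b * f2" and "d1 \<equiv> d * f1" and "d2 \<equiv> d * f2"
  assumes deg: "degree a \<le> k" "degree b1 \<le> k" "degree b2 \<le> k"
    "degree c \<le> k" "degree d1 \<le> k" "degree d2 \<le> k"
  defines "U1 \<equiv> shift_comb k a x + shift_comb k b1 y"
    and "U2 \<equiv> shift_comb k b2 x + shift_comb k a y"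
    and "V1 \<equiv> shift_comb k c x + shift_comb k d1 y"
    and "V2 \<equiv> shift_comb k d2 x + shift_comb k c y"
  defines "W1 \<equiv> b2 * V1 + a * V2 - (d2 * U1 + c * U2)"
    and "W2 \<equiv> a * V1 + b1 * V2 - (c * U1 + d1 * U2)"
  shows "resultant_matrix k f1 f2 a b c d *\<^sub>v (vec k x @\<^sub>v vec k y)
      = vec k (coeff W1) @\<^sub>v vec k (coeff W2)"
    and "k \<le> i \<Longrightarrow> coeff W1 i = 0" and "k \<le> i \<Longrightarrow> coeff W2 i = 0"
proof -
  \<comment> \<open>Evaluated at \<open>Suc j\<close>, each of these is the polynomial whose
    coefficients form column \<open>j\<close> of the corresponding block.\<close>
  define G11 where "G11 n = bez_col n b2 c - bez_col n d2 a + (bez_col n a d2 - bez_col n c b2)" for n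
  define G12 where "G12 n = bez_col n a c - bez_col n c a + (bez_col n b1 d2 - bez_col n d1 b2)" for n
  define G21 where "G21 n = bez_col n a c - bez_col n c a + (bez_col n b2 d1 - bez_col n d2 b1)" for n
  define G22 where "G22 n = bez_col n b1 c - bez_col n d1 a + (bez_col n a d1 - bez_col n c b1)" for n
  note Gs = G11_def G12_def G21_def G22_def
  have comm: "d1 * b2 = b1 * d2" "d2 * b1 = b2 * d1"
    by (simp_all add: b1_def b2_def d1_def d2_def ac_simps)
  let ?S = poly_shift
  have G': "G11 n = ?S n d2 * a + ?S n c * b2 - ?S n b2 * c - ?S n a * d2"
    "G12 n = ?S n c * a + ?S n d1 * b2 - ?S n a * c - ?S n b1 * d2"
    "G21 n = ?S n c * a + ?S n d2 * b1 - ?S n a * c - ?S n b2 * d1"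
    "G22 n = ?S n d1 * a + ?S n c * b1 - ?S n b1 * c - ?S n a * d1" for n
    unfolding Gs bez_col_eq comm
    by (simp_all add: mult.commute[of c a] mult.commute[of b2 c] mult.commute[of d2 a]
        mult.commute[of b1 c] mult.commute[of d1 a])
  have W1: "W1 = (\<Sum>j<k. smult (x j) (G11 (Suc j)) + smult (y j) (G12 (Suc j)))"
    unfolding W1_def U1_def U2_def V1_def V2_def shift_comb_def G'
    by (simp add: sum_distrib_left ring_distribs sum.distrib sum_subtractf smult_diff_right
        smult_add_right mult.commute)
  have W2: "W2 = (\<Sum>j<k. smult (x j) (G21 (Suc j)) + smult (y j) (G22 (Suc j)))"
    unfolding W2_def U1_def U2_def V1_def V2_def shift_comb_def G'
    by (simp add: sum_distrib_left ring_distribs sum.distrib sum_subtractf smult_diff_right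
        smult_add_right mult.commute)
  show "coeff W1 i = 0" "coeff W2 i = 0" if "k \<le> i"
    using that deg unfolding W1 W2 Gs
    by (simp_all add: coeff_sum coeff_bez_col_eq_0[where k = k])
  let ?u = "col2 a c" and ?u1 = "col2 b1 d1" and ?u2 = "col2 b2 d2"
  define A11 where "A11 = mat_from_1 k (\<lambda>i j.
      sum_lt k i j (\<lambda>p q. minor2 (?u2 p) (?u q) + minor2 (?u p) (?u2 q)))"
  define A12 where "A12 = mat_from_1 k (\<lambda>i j.
      sum_lt k i j (\<lambda>p q. minor2 (?u p) (?u q)) + sum_all k i j (\<lambda>p q. minor2 (?u1 p) (?u2 q)))"
  define A21 where "A21 = mat_from_1 k (\<lambda>i j.
      sum_lt k i j (\<lambda>p q. minor2 (?u p) (?u q)) + sum_all k i j (\<lambda>p q. minor2 (?u2 p) (?u1 q)))"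
  define A22 where "A22 = mat_from_1 k (\<lambda>i j.
      sum_lt k i j (\<lambda>p q. minor2 (?u1 p) (?u q) + minor2 (?u p) (?u1 q)))"
  note As = A11_def A12_def A21_def A22_def
  have R: "resultant_matrix k f1 f2 a b c d = four_block_mat A11 A12 A21 A22"
    unfolding resultant_matrix_def Let_def As b1_def b2_def d1_def d2_def ..
  have carr: "A11 \<in> carrier_mat k k" "A12 \<in> carrier_mat k k"
    "A21 \<in> carrier_mat k k" "A22 \<in> carrier_mat k k"
    by (simp_all add: As mat_from_1_def)
  \<comment> \<open>Exchanging \<open>p\<close> and \<open>q\<close> negates the sum of the two
    mixed minors, though not each one alone.\<close>
  have lt: "sum_lt k (Suc i) (Suc j) (\<lambda>p q. minor2 (u p) (u' q) + minor2 (u' p) (u q))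
      = sum_all k (Suc i) (Suc j) (\<lambda>p q. minor2 (u p) (u' q) + minor2 (u' p) (u q))"
    if "i < k" "j < k" for i j and u u' :: "nat \<Rightarrow> 'a \<times> 'a"
    using that by (intro sum_lt_eq_sum_all) (auto simp: minor2_def algebra_simps)
  have lt': "sum_lt k (Suc i) (Suc j) (\<lambda>p q. minor2 (u p) (u q))
      = sum_all k (Suc i) (Suc j) (\<lambda>p q. minor2 (u p) (u q))"
    if "i < k" "j < k" for i j and u :: "nat \<Rightarrow> 'a \<times> 'a"
    using that by (intro sum_lt_eq_sum_all) (auto simp: minor2_def algebra_simps)
  have entries: "A11 $$ (i, j) = coeff (G11 (Suc j)) i" "A12 $$ (i, j) = coeff (G12 (Suc j)) i"
    "A21 $$ (i, j) = coeff (G21 (Suc j)) i" "A22 $$ (i, j) = coeff (G22 (Suc j)) i"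
    if "i < k" "j < k" for i j
    using that deg unfolding As Gs
    by (simp_all add: mat_from_1_def lt lt' sum_all_add sum_all_minor2)
  have "A11 *\<^sub>v vec k x + A12 *\<^sub>v vec k y = vec k (coeff W1)"
    by (rule eq_vecI) (use carr in \<open>auto simp: W1 coeff_sum scalar_prod_def entries sum.distrib
        atLeast0LessThan mult.commute\<close>)
  moreover have "A21 *\<^sub>v vec k x + A22 *\<^sub>v vec k y = vec k (coeff W2)"
    by (rule eq_vecI) (use carr in \<open>auto simp: W2 coeff_sum scalar_prod_def entries sum.distrib
        atLeast0LessThan mult.commute\<close>)
  ultimately show "resultant_matrix k f1 f2 a b c d *\<^sub>v (vec k x @\<^sub>v vec k y)
      = vec k (coeff W1) @\<^sub>v vec k (coeff W2)"
    unfolding R by (subst four_block_mat_mult_vec[OF carr]) auto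
qed


section \<open>Common kernels and syzygies\<close>

text \<open>The kernel of the matrices with rows \<open>(a, b1), (b2, a)\<close> and \<open>(c, d1), (d2, c)\<close>, which commute
  if \<open>b1 d2 = d1 b2\<close>.\<close>

definition common_kernel :: "'r::comm_ring_1 \<Rightarrow> 'r \<Rightarrow> 'r \<Rightarrow> 'r \<Rightarrow> 'r \<Rightarrow> 'r \<Rightarrow> 'r \<Rightarrow> 'r \<Rightarrow> bool" where
  "common_kernel a b1 b2 c d1 d2 x y \<longleftrightarrow>
     a * x + b1 * y = 0 \<and> b2 * x + a * y = 0 \<and> c * x + d1 * y = 0 \<and> d2 * x + c * y = 0"

definition trivial_common_kernel :: "'r::comm_ring_1 \<Rightarrow> 'r \<Rightarrow> 'r \<Rightarrow> 'r \<Rightarrow> 'r \<Rightarrow> 'r \<Rightarrow> bool" where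
  "trivial_common_kernel a b1 b2 c d1 d2 \<longleftrightarrow>
     (\<forall>x y. common_kernel a b1 b2 c d1 d2 x y \<longrightarrow> x = 0 \<and> y = 0)"

text \<open>The matrix with rows \<open>(0, p)\<close> and \<open>(q, 0)\<close> has the square
  roots of \<open>p * q\<close> as eigenvalues. Conversely, a common kernel vector forces
  \<open>a\<^sup>2 = b\<^sup>2 * (p * q)\<close>, likewise for \<open>c\<close> and
  \<open>d\<close>, and \<open>b * c = a * d\<close>; then \<open>y\<close> is
  \<open>- a / b\<close> or \<open>- c / d\<close>.\<close>

lemma nontrivial_common_kernel_iff:
  fixes a b c d p q :: "'a::alg_closed_field"
  shows "\<not> trivial_common_kernel a (b * p) (b * q) c (d * p) (d * q) \<longleftrightarrow>
    (\<exists>y. y\<^sup>2 = p * q \<and> a + b * y = 0 \<and> c + d * y = 0)"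
proof
  assume "\<exists>y. y\<^sup>2 = p * q \<and> a + b * y = 0 \<and> c + d * y = 0"
  then obtain y where y: "y\<^sup>2 = p * q" and "a = - (b * y)" "c = - (d * y)"
    by (auto simp: add_eq_0_iff2)
  \<comment> \<open>\<open>(p, y)\<close> and \<open>(y, q)\<close> are eigenvectors for
    \<open>y\<close> unless zero; if both are zero, the matrix is zero and every vector
    serves.\<close>
  then have "common_kernel a (b * p) (b * q) c (d * p) (d * q) p y"
    "common_kernel a (b * p) (b * q) c (d * p) (d * q) y q"
    "p = 0 \<and> y = 0 \<and> q = 0 \<Longrightarrow> common_kernel a (b * p) (b * q) c (d * p) (d * q) 1 1"
    by (auto simp: common_kernel_def algebra_simps power2_eq_square)
  then show "\<not> trivial_common_kernel a (b * p) (b * q) c (d * p) (d * q)"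
    unfolding trivial_common_kernel_def by (metis zero_neq_one)
next
  assume "\<not> trivial_common_kernel a (b * p) (b * q) c (d * p) (d * q)"
  then obtain x1 x2 where nz: "x1 \<noteq> 0 \<or> x2 \<noteq> 0"
    and e: "a * x1 = - (b * p * x2)" "a * x2 = - (b * q * x1)"
      "c * x1 = - (d * p * x2)" "c * x2 = - (d * q * x1)"
    by (auto simp: trivial_common_kernel_def common_kernel_def add_eq_0_iff2 add.commute)
  have cancel: "r = s" if "r * x1 = s * x1" "r * x2 = s * x2" for r s
    using nz that by auto
  have mm: "r * s * z1 = s1 * r2 * z1"
    if "s * z1 = - (s1 * z2)" "r * z2 = - (r2 * z1)" for r s s1 r2 z1 z2 :: 'a
  proof -
    have "r * s * z1 = - (s1 * (r * z2))"
      using arg_cong[OF that(1), of "\<lambda>w. r * w"] by (simp add: ac_simps)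
    then show ?thesis by (simp add: that(2) ac_simps)
  qed
  have "a * a = (b * p) * (b * q)"
    by (rule cancel, rule mm[OF e(1,2)]) (subst mm[OF e(2,1)], simp only: ac_simps)
  then have sq: "a\<^sup>2 = b\<^sup>2 * (p * q)"
    by (simp add: power2_eq_square ac_simps)
  have "c * c = (d * p) * (d * q)"
    by (rule cancel, rule mm[OF e(3,4)]) (subst mm[OF e(4,3)], simp only: ac_simps)
  then have sq': "c\<^sup>2 = d\<^sup>2 * (p * q)"
    by (simp add: power2_eq_square ac_simps)
  have cross: "b * c = a * d"
  proof (rule cancel)
    have "b * (c * x1) = d * (a * x1)" "b * (c * x2) = d * (a * x2)"
      unfolding e by (simp_all add: ac_simps)
    then show "b * c * x1 = a * d * x1" "b * c * x2 = a * d * x2"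
      by (simp_all add: ac_simps)
  qed
  consider "b \<noteq> 0" | "d \<noteq> 0" | "b = 0" "d = 0" by blast
  then show "\<exists>y. y\<^sup>2 = p * q \<and> a + b * y = 0 \<and> c + d * y = 0"
  proof cases
    case 1
    then show ?thesis
      using sq cross by (intro exI[of _ "- a / b"]) (simp add: field_simps power2_eq_square)
  next
    case 2
    then show ?thesis
      using sq' cross by (intro exI[of _ "- c / d"]) (simp add: field_simps power2_eq_square)
  next
    case 3
    \<comment> \<open>The squared equations now give \<open>a = c = 0\<close>, so any square root
      will do.\<close>
    obtain y where "y\<^sup>2 = p * q"
      using nth_root_exists[of 2 "p * q"] by auto
    then show ?thesis using 3 sq sq' by auto
  qed
qed

text \<open>Dividing out the roots of the common denominator \<open>h\<close> one by one.\<close>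

lemma clear_denominator:
  fixes h :: "'a::alg_closed_field poly"
  assumes triv: "\<And>t. trivial_common_kernel (poly a t) (poly b1 t) (poly b2 t)
      (poly c t) (poly d1 t) (poly d2 t)"
    and "h \<noteq> 0"
    and "a * z1 + b1 * z2 = h * u1" "b2 * z1 + a * z2 = h * u2"
    and "c * z1 + d1 * z2 = h * v1" "d2 * z1 + c * z2 = h * v2"
  shows "\<exists>z1 z2. a * z1 + b1 * z2 = u1 \<and> b2 * z1 + a * z2 = u2 \<and>
    c * z1 + d1 * z2 = v1 \<and> d2 * z1 + c * z2 = v2"
  using assms(2-)
proof (induction "degree h" arbitrary: h z1 z2)
  case 0
  then obtain e where e: "h = [:e:]" "e \<noteq> 0"
    by (metis degree_eq_zeroE pCons_0_0)
  have "r = h * s \<Longrightarrow> smult (inverse e) r = s" for r s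
    using e by simp
  then show ?case
    using "0.prems"
    by (intro exI[of _ "smult (inverse e) z1"] exI[of _ "smult (inverse e) z2"])
      (simp add: smult_add_right[symmetric])
next
  case (Suc n)
  then obtain t where "poly h t = 0"
    using alg_closed_imp_poly_has_root[of h] by auto
  then obtain h' where h': "h = [:-t, 1:] * h'"
    by (auto simp: poly_eq_0_iff_dvd)
  \<comment> \<open>At a root of \<open>h\<close> all four right-hand sides vanish, so
    \<open>z1\<close> and \<open>z2\<close> share this root.\<close>
  have "common_kernel (poly a t) (poly b1 t) (poly b2 t) (poly c t) (poly d1 t) (poly d2 t)
      (poly z1 t) (poly z2 t)"
    using Suc.prems(2-5)[THEN arg_cong, of "\<lambda>p. poly p t"] \<open>poly h t = 0\<close>
    by (simp add: common_kernel_def)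
  then have "poly z1 t = 0" "poly z2 t = 0"
    using triv[of t] by (auto simp: trivial_common_kernel_def)
  then obtain z1' z2' where z: "z1 = [:-t, 1:] * z1'" "z2 = [:-t, 1:] * z2'"
    unfolding poly_eq_0_iff_dvd by (elim dvdE)
  have "h' \<noteq> 0" using Suc.prems(1) h' by auto
  then have "degree h = Suc (degree h')"
    unfolding h' by (subst degree_mult_eq) auto
  then have "n = degree h'" using Suc.hyps(2) by simp
  moreover have cancel: "r * z1' + s * z2' = h' * w" if "r * z1 + s * z2 = h * w" for r s w
  proof -
    have "[:-t, 1:] * (r * z1' + s * z2') = [:-t, 1:] * (h' * w)"
      using that unfolding z h' by (simp only: algebra_simps)
    then show ?thesis by (subst (asm) mult_cancel_left) simp
  qed
  ultimately show ?case
    using Suc.hyps(1)[of h' z1' z2'] \<open>h' \<noteq> 0\<close> Suc.prems(2-5)[THEN cancel] by blast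
qed

text \<open>The vector on the left is \<open>adj(P) U\<close>. Besides
  \<open>P adj(P) = det(P)\<close>, the matrix \<open>adj(P) = 2 a - P\<close> commutes with
  \<open>Q\<close>, so \<open>Q adj(P) U = adj(P) Q U = adj(P) P V = det(P) V\<close>.\<close>

lemma cramer_syzygy:
  fixes a :: "'r::comm_ring_1"
  assumes comm: "b1 * d2 = d1 * b2"
    and syz: "a * v1 + b1 * v2 = c * u1 + d1 * u2" "b2 * v1 + a * v2 = d2 * u1 + c * u2"
  shows "a * (a * u1 - b1 * u2) + b1 * (a * u2 - b2 * u1) = (a * a - b1 * b2) * u1"
    and "b2 * (a * u1 - b1 * u2) + a * (a * u2 - b2 * u1) = (a * a - b1 * b2) * u2"
    and "c * (a * u1 - b1 * u2) + d1 * (a * u2 - b2 * u1) = (a * a - b1 * b2) * v1"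
    and "d2 * (a * u1 - b1 * u2) + c * (a * u2 - b2 * u1) = (a * a - b1 * b2) * v2"
proof -
  show "a * (a * u1 - b1 * u2) + b1 * (a * u2 - b2 * u1) = (a * a - b1 * b2) * u1"
    "b2 * (a * u1 - b1 * u2) + a * (a * u2 - b2 * u1) = (a * a - b1 * b2) * u2"
    by (simp_all add: algebra_simps)
  have "c * (a * u1 - b1 * u2) + d1 * (a * u2 - b2 * u1)
      = a * (c * u1 + d1 * u2) - b1 * (d2 * u1 + c * u2) + (b1 * d2 - d1 * b2) * u1"
    by (simp add: algebra_simps)
  also have "\<dots> = (a * a - b1 * b2) * v1"
    unfolding comm syz[symmetric] by (simp add: algebra_simps)
  finally show "c * (a * u1 - b1 * u2) + d1 * (a * u2 - b2 * u1) = (a * a - b1 * b2) * v1" .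
  have "d2 * (a * u1 - b1 * u2) + c * (a * u2 - b2 * u1)
      = a * (d2 * u1 + c * u2) - b2 * (c * u1 + d1 * u2) + (d1 * b2 - b1 * d2) * u2"
    by (simp add: algebra_simps)
  also have "\<dots> = (a * a - b1 * b2) * v2"
    unfolding comm syz[symmetric] by (simp add: algebra_simps)
  finally show "d2 * (a * u1 - b1 * u2) + c * (a * u2 - b2 * u1) = (a * a - b1 * b2) * v2" .
qed

text \<open>Over the field of rational functions \<open>z\<close> is the inverse of \<open>P\<close>
  applied to \<open>U\<close>, or that of \<open>Q\<close> applied to \<open>V\<close>, whichever
  exists by \<open>det\<close>. Without common zeros the determinant in its denominator can be
  cleared.\<close>

lemma syzygy_factorization:
  fixes a :: "'a::alg_closed_field poly"
  assumes triv: "\<And>t. trivial_common_kernel (poly a t) (poly b1 t) (poly b2 t)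
      (poly c t) (poly d1 t) (poly d2 t)"
    and comm: "b1 * d2 = d1 * b2"
    and det: "a\<^sup>2 \<noteq> b1 * b2 \<or> c\<^sup>2 \<noteq> d1 * d2"
    and syz: "a * v1 + b1 * v2 = c * u1 + d1 * u2" "b2 * v1 + a * v2 = d2 * u1 + c * u2"
  shows "\<exists>z1 z2. a * z1 + b1 * z2 = u1 \<and> b2 * z1 + a * z2 = u2 \<and>
    c * z1 + d1 * z2 = v1 \<and> d2 * z1 + c * z2 = v2"
  using det
proof
  assume "a\<^sup>2 \<noteq> b1 * b2"
  then have "a * a - b1 * b2 \<noteq> 0" by (simp add: power2_eq_square)
  then show ?thesis
    by (rule clear_denominator[OF triv]) (rule cramer_syzygy[OF comm syz])+
next
  assume "c\<^sup>2 \<noteq> d1 * d2"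
  then have "c * c - d1 * d2 \<noteq> 0" by (simp add: power2_eq_square)
  then show ?thesis
    by (rule clear_denominator[OF triv])
      (rule cramer_syzygy[OF comm[symmetric] syz[symmetric]])+
qed

section \<open>Degree comparison at infinity\<close>

lemma coeff_mult_top:
  assumes "degree u \<le> k" "degree z \<le> e"
  shows "coeff (u * z) (k + e) = coeff u k * coeff (z :: 'a::comm_ring_1 poly) e"
proof -
  have "coeff (u * z) (k + e) = (\<Sum>i\<le>k + e. if i = k then coeff u k * coeff z e else 0)"
    unfolding coeff_mult
  proof (rule sum.cong)
    fix i assume "i \<in> {..k + e}"
    consider "i < k" | "i = k" | "i > k" by linarith
    then show "coeff u i * coeff z (k + e - i) = (if i = k then coeff u k * coeff z e else 0)"
      by cases (use assms in \<open>auto simp: coeff_eq_0\<close>)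
  qed simp
  then show ?thesis by simp
qed

text \<open>With \<open>e\<close> the larger degree of \<open>z1\<close> and \<open>z2\<close>, the
  coefficients of \<open>t^(k+e)\<close> are the leading matrices applied to the coefficients of
  \<open>t^e\<close> in \<open>z1\<close> and \<open>z2\<close>. They vanish, so both of these
  coefficients do.\<close>

lemma quotient_eq_0:
  fixes a :: "'a::comm_ring_1 poly"
  assumes triv: "trivial_common_kernel (coeff a k) (coeff b1 k) (coeff b2 k)
      (coeff c k) (coeff d1 k) (coeff d2 k)"
    and deg: "degree a \<le> k" "degree b1 \<le> k" "degree b2 \<le> k"
      "degree c \<le> k" "degree d1 \<le> k" "degree d2 \<le> k"
    and u: "\<And>i. i \<ge> k \<Longrightarrow> coeff (a * z1 + b1 * z2) i = 0" "\<And>i. i \<ge> k \<Longrightarrow> coeff (b2 * z1 + a * z2) i = 0"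
    and v: "\<And>i. i \<ge> k \<Longrightarrow> coeff (c * z1 + d1 * z2) i = 0" "\<And>i. i \<ge> k \<Longrightarrow> coeff (d2 * z1 + c * z2) i = 0"
  shows "z1 = 0 \<and> z2 = 0"
proof -
  define e where "e = max (degree z1) (degree z2)"
  have "common_kernel (coeff a k) (coeff b1 k) (coeff b2 k) (coeff c k) (coeff d1 k) (coeff d2 k)
      (coeff z1 e) (coeff z2 e)"
    using u[of "k + e"] v[of "k + e"] deg
    by (simp add: common_kernel_def coeff_mult_top e_def)
  then have "coeff z1 e = 0" "coeff z2 e = 0"
    using triv by (auto simp: trivial_common_kernel_def)
  moreover have "degree z1 \<le> e" "degree z2 \<le> e" "e = degree z1 \<or> e = degree z2"
    by (auto simp: e_def)
  ultimately show ?thesis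
    by (metis degree_0 le_zero_eq leading_coeff_0_iff)
qed

section \<open>Coefficients of combined shifts\<close>

lemma coeff_shift_comb: "coeff (shift_comb k u x) i = (\<Sum>j<k. x j * coeff u (i + Suc j))"
  by (simp add: shift_comb_def coeff_sum coeff_poly_shift)

lemma coeff_shift_comb_eq_0: "degree u \<le> k \<Longrightarrow> k \<le> i \<Longrightarrow> coeff (shift_comb k u x) i = 0"
  by (simp add: coeff_shift_comb coeff_eq_0)

text \<open>Triangularity: weights after \<open>j\<close> meet coefficients of \<open>u\<close>
  beyond degree \<open>k\<close>, and those before \<open>j\<close> are zero, which isolates
  \<open>x j\<close>.\<close>

lemma coeff_shift_comb_top:
  assumes "degree u \<le> k" "j < k" "\<And>l. l < j \<Longrightarrow> x l = 0"
  shows "coeff (shift_comb k u x) (k - Suc j) = x j * coeff u k"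
proof -
  have "coeff (shift_comb k u x) (k - Suc j) = (\<Sum>l<k. if l = j then x j * coeff u k else 0)"
    unfolding coeff_shift_comb
  proof (rule sum.cong)
    fix l assume "l \<in> {..<k}"
    consider "l < j" | "l = j" | "l > j" by linarith
    then show "x l * coeff u (k - Suc j + Suc l) = (if l = j then x j * coeff u k else 0)"
      by cases (use assms in \<open>auto simp: coeff_eq_0\<close>)
  qed simp
  with assms show ?thesis by simp
qed

text \<open>Synthetic division by \<open>[:-t, 1:]\<close>: each shift times this factor is a
  difference of consecutive terms up to a constant, so the weighted sum telescopes.\<close>

lemma shift_comb_power:
  fixes u :: "'a::field poly"
  assumes "degree u \<le> k"
  shows "[:-t, 1:] * shift_comb k u (\<lambda>j. e * t ^ j) = smult e (u - [:poly u t:])"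
proof -
  have shift: "[:-t, 1:] * poly_shift (Suc j) u
      = poly_shift j u - smult t (poly_shift (Suc j) u) - [:coeff u j:]" for j
    by (simp add: poly_eq_iff coeff_pCons coeff_poly_shift split: nat.splits)
  have "shift_comb k u (\<lambda>j. e * t ^ j) = smult e (shift_comb k u (\<lambda>j. t ^ j))"
    by (simp add: poly_eq_iff coeff_shift_comb sum_distrib_left mult.assoc)
  then have "[:-t, 1:] * shift_comb k u (\<lambda>j. e * t ^ j)
      = smult e (\<Sum>j<k. smult (t ^ j) ([:-t, 1:] * poly_shift (Suc j) u))"
    by (simp only: shift_comb_def sum_distrib_left mult_smult_right)
  also have "\<dots> = smult e ((\<Sum>j<k. smult (t ^ j) (poly_shift j u)
        - smult (t ^ Suc j) (poly_shift (Suc j) u)) - (\<Sum>j<k. [:coeff u j * t ^ j:]))"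
    unfolding shift by (simp add: smult_diff_right sum_subtractf mult.commute)
  also have "(\<Sum>j<k. smult (t ^ j) (poly_shift j u) - smult (t ^ Suc j) (poly_shift (Suc j) u))
      = u - smult (t ^ k) (poly_shift k u)"
    by (subst sum_lessThan_telescope') simp
  also have "poly_shift k u = [:coeff u k:]"
    using assms by (auto simp: poly_eq_iff coeff_poly_shift coeff_pCons coeff_eq_0 split: nat.splits)
  also have "(\<Sum>j<k. [:coeff u j * t ^ j:]) = [:\<Sum>j<k. coeff u j * t ^ j:]"
    by (induction k) auto
  also have "u - smult (t ^ k) [:coeff u k:] - [:\<Sum>j<k. coeff u j * t ^ j:] = u - [:poly u t:]"
  proof -
    \<comment> \<open>Homogenization at \<open>x0 = 1\<close> is evaluation, summed up to
      \<open>k\<close> instead of \<open>degree u\<close>.\<close>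
    have "poly u t = (\<Sum>j\<le>k. coeff u j * t ^ j)"
      using homogenize_one[OF assms, of t] by (simp add: homogenize_def)
    also have "\<dots> = (\<Sum>j<k. coeff u j * t ^ j) + coeff u k * t ^ k"
      by (simp flip: lessThan_Suc_atMost)
    finally show ?thesis by (simp add: mult.commute)
  qed
  finally show ?thesis .
qed

section \<open>The determinant criterion\<close>

lemma resultant_matrix_carrier:
  "resultant_matrix k f1 f2 a b c d \<in> carrier_mat (k + k) (k + k)"
  unfolding resultant_matrix_def Let_def mat_from_1_def by (intro four_block_carrier_mat) auto

lemma ex_append_vec_iff:
  "(\<exists>v. v \<in> carrier_vec (k + k) \<and> Q v) \<longleftrightarrow> (\<exists>x y. Q (vec k x @\<^sub>v vec k y))"
proof
  assume "\<exists>v. v \<in> carrier_vec (k + k) \<and> Q v"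
  then obtain v where v: "v \<in> carrier_vec (k + k)" "Q v" by blast
  then have "v = vec k (vec_index v) @\<^sub>v vec k (\<lambda>j. vec_index v (k + j))"
    by (intro eq_vecI) auto
  with v show "\<exists>x y. Q (vec k x @\<^sub>v vec k y)" by metis
next
  assume "\<exists>x y. Q (vec k x @\<^sub>v vec k y)"
  moreover have "vec k x @\<^sub>v vec k y \<in> carrier_vec (k + k)" for x y :: "nat \<Rightarrow> 'a"
    by auto
  ultimately show "\<exists>v. v \<in> carrier_vec (k + k) \<and> Q v" by blast
qed

lemma append_vec_eq_0_iff:
  "vec k x @\<^sub>v vec k y = 0\<^sub>v (k + k) \<longleftrightarrow> (\<forall>j<k. x j = 0 \<and> y j = 0)"
proof -
  have "(0\<^sub>v (k + k) :: 'a vec) = vec k (\<lambda>_. 0) @\<^sub>v vec k (\<lambda>_. 0)"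
    by (intro eq_vecI) auto
  then show ?thesis
    by (simp only: append_vec_eq[OF vec_carrier vec_carrier]) (auto simp: vec_eq_iff)
qed

text \<open>A null vector amounts to nonzero weights with \<open>P V = Q U\<close>. The assumption
  \<open>det\<close> says that \<open>P\<close> or \<open>Q\<close> has nonzero determinant as a
  polynomial matrix; it permits division and settles \<open>k = 0\<close>.\<close>

lemma det_resultant_matrix_eq_0_iff:
  fixes a b c d f1 f2 :: "'a::alg_closed_field poly"
  defines "b1 \<equiv> b * f1" and "b2 \<equiv> b * f2" and "d1 \<equiv> d * f1" and "d2 \<equiv> d * f2"
  assumes deg: "degree a \<le> k" "degree b1 \<le> k" "degree b2 \<le> k"
      "degree c \<le> k" "degree d1 \<le> k" "degree d2 \<le> k"
    and det: "a\<^sup>2 \<noteq> b1 * b2 \<or> c\<^sup>2 \<noteq> d1 * d2"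
  shows "det (resultant_matrix k f1 f2 a b c d) = 0 \<longleftrightarrow>
    (\<exists>t. \<not> trivial_common_kernel (poly a t) (poly b1 t) (poly b2 t) (poly c t) (poly d1 t) (poly d2 t)) \<or>
    \<not> trivial_common_kernel (coeff a k) (coeff b1 k) (coeff b2 k) (coeff c k) (coeff d1 k) (coeff d2 k)"
    (is "_ \<longleftrightarrow> (\<exists>t. \<not> ?fin t) \<or> \<not> ?inf")
proof -
  have comm: "b1 * d2 = d1 * b2"
    by (simp add: b1_def b2_def d1_def d2_def ac_simps)
  define U1 where "U1 x y = shift_comb k a x + shift_comb k b1 y" for x y
  define U2 where "U2 x y = shift_comb k b2 x + shift_comb k a y" for x y
  define V1 where "V1 x y = shift_comb k c x + shift_comb k d1 y" for x y
  define V2 where "V2 x y = shift_comb k d2 x + shift_comb k c y" for x y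
  note UV_def = U1_def U2_def V1_def V2_def
  define syz where "syz x y \<longleftrightarrow> a * V1 x y + b1 * V2 x y = c * U1 x y + d1 * U2 x y \<and>
      b2 * V1 x y + a * V2 x y = d2 * U1 x y + c * U2 x y" for x y
  have kernel: "resultant_matrix k f1 f2 a b c d *\<^sub>v (vec k x @\<^sub>v vec k y) = 0\<^sub>v (k + k)
      \<longleftrightarrow> syz x y" for x y
  proof -
    define W1 where "W1 = b2 * V1 x y + a * V2 x y - (d2 * U1 x y + c * U2 x y)"
    define W2 where "W2 = a * V1 x y + b1 * V2 x y - (c * U1 x y + d1 * U2 x y)"
    note * = resultant_matrix_mult_vec[where a = a and b = b and c = c and d = d and x = x and y = y
          and k = k and ?f1.0 = f1 and ?f2.0 = f2, folded b1_def b2_def d1_def d2_def,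
        OF deg, folded UV_def, folded W1_def W2_def]
    have "(\<forall>j<k. coeff W1 j = 0 \<and> coeff W2 j = 0) \<longleftrightarrow> W1 = 0 \<and> W2 = 0"
      using *(2,3) by (metis coeff_0 linorder_not_less poly_eqI)
    then show ?thesis
      unfolding *(1) append_vec_eq_0_iff by (auto simp: syz_def W1_def W2_def)
  qed
  have det_iff: "det (resultant_matrix k f1 f2 a b c d) = 0 \<longleftrightarrow>
      (\<exists>x y. (\<exists>j<k. x j \<noteq> 0 \<or> y j \<noteq> 0) \<and> syz x y)"
    unfolding det_0_iff_vec_prod_zero_field[OF resultant_matrix_carrier] ex_append_vec_iff
      kernel append_vec_eq_0_iff by auto
  \<comment> \<open>For \<open>k = 0\<close> the matrix is empty, with determinant 1. Then
    \<open>P\<close> and \<open>Q\<close> are constant and one of them is invertible, so no kernel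
    vector exists either.\<close>
  have k_pos: "k > 0" if "(\<exists>t. \<not> ?fin t) \<or> \<not> ?inf"
  proof (rule ccontr)
    assume "\<not> k > 0"
    then have k: "k = 0" by simp
    have const: "poly p t = coeff p 0" "p = [:coeff p 0:]" if "degree p \<le> k" for p :: "'a poly" and t
      using that k by (auto elim!: degree_eq_zeroE)
    have mult: "p * q = [:coeff p 0 * coeff q 0:]" if "degree p \<le> k" "degree q \<le> k" for p q :: "'a poly"
      by (subst const(2)[OF that(1)], subst const(2)[OF that(2)]) simp
    have det0: "(coeff a 0)\<^sup>2 - coeff b1 0 * coeff b2 0 \<noteq> 0 \<or> (coeff c 0)\<^sup>2 - coeff d1 0 * coeff d2 0 \<noteq> 0"
      using det unfolding power2_eq_square mult[OF deg(1,1)] mult[OF deg(2,3)] mult[OF deg(4,4)]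
        mult[OF deg(5,6)] by auto
    have cramer: "x = 0 \<and> y = 0"
      if "\<alpha>\<^sup>2 - \<beta>1 * \<beta>2 \<noteq> 0" "\<alpha> * x + \<beta>1 * y = 0" "\<beta>2 * x + \<alpha> * y = 0"
      for \<alpha> \<beta>1 \<beta>2 x y :: 'a
    proof -
      have "(\<alpha>\<^sup>2 - \<beta>1 * \<beta>2) * x = \<alpha> * (\<alpha> * x + \<beta>1 * y) - \<beta>1 * (\<beta>2 * x + \<alpha> * y)"
        "(\<alpha>\<^sup>2 - \<beta>1 * \<beta>2) * y = \<alpha> * (\<beta>2 * x + \<alpha> * y) - \<beta>2 * (\<alpha> * x + \<beta>1 * y)"
        by (simp_all add: power2_eq_square algebra_simps)
      then show ?thesis using that(1) unfolding that(2,3) by simp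
    qed
    have "trivial_common_kernel (coeff a 0) (coeff b1 0) (coeff b2 0)
        (coeff c 0) (coeff d1 0) (coeff d2 0)"
      using det0 cramer unfolding trivial_common_kernel_def common_kernel_def by meson
    with that show False
      using const(1) deg k by simp
  qed
  show ?thesis
  proof
    assume "det (resultant_matrix k f1 f2 a b c d) = 0"
    then obtain x y where nz: "\<exists>j<k. x j \<noteq> 0 \<or> y j \<noteq> 0" and syz: "syz x y"
      unfolding det_iff by blast
    show "(\<exists>t. \<not> ?fin t) \<or> \<not> ?inf"
    proof (rule ccontr)
      assume "\<not> ?thesis"
      then have fin: "\<And>t. ?fin t" and inf: ?inf by auto
      have "\<exists>z1 z2. a * z1 + b1 * z2 = U1 x y \<and> b2 * z1 + a * z2 = U2 x y \<and>
          c * z1 + d1 * z2 = V1 x y \<and> d2 * z1 + c * z2 = V2 x y"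
        using syz by (intro syzygy_factorization[OF fin comm det]) (simp_all add: syz_def)
      then obtain z1 z2 where z: "a * z1 + b1 * z2 = U1 x y" "b2 * z1 + a * z2 = U2 x y"
          "c * z1 + d1 * z2 = V1 x y" "d2 * z1 + c * z2 = V2 x y"
        by blast
      \<comment> \<open>\<open>U\<close> and \<open>V\<close> have degree below \<open>k\<close>, as
        built from shifts by at least one.\<close>
      have "z1 = 0 \<and> z2 = 0"
        by (rule quotient_eq_0[OF inf deg])
          (use deg in \<open>simp_all only: z, simp_all add: UV_def coeff_shift_comb_eq_0\<close>)
      with z have zero: "U1 x y = 0" "U2 x y = 0" "V1 x y = 0" "V2 x y = 0"
        by auto
      have "x j = 0 \<and> y j = 0" if "j < k" for j
        using that
      proof (induction j rule: less_induct)
        case (less j)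
        then have top: "coeff (shift_comb k p x) (k - Suc j) = x j * coeff p k"
            "coeff (shift_comb k p y) (k - Suc j) = y j * coeff p k" if "degree p \<le> k" for p
          using that by (auto intro!: coeff_shift_comb_top)
        have "common_kernel (coeff a k) (coeff b1 k) (coeff b2 k) (coeff c k) (coeff d1 k) (coeff d2 k)
            (x j) (y j)"
          using zero[THEN arg_cong, of "\<lambda>p. coeff p (k - Suc j)"] deg
          by (simp add: UV_def top common_kernel_def mult.commute)
        then show ?case using inf by (auto simp: trivial_common_kernel_def)
      qed
      with nz show False by blast
    qed
  next
    assume ex: "(\<exists>t. \<not> ?fin t) \<or> \<not> ?inf"
    note k = k_pos[OF ex]
    show "det (resultant_matrix k f1 f2 a b c d) = 0"
      unfolding det_iff
      using ex
    proof
      assume "\<exists>t. \<not> ?fin t"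
      then obtain t x y where nz: "x \<noteq> 0 \<or> y \<noteq> 0" and
        ker: "common_kernel (poly a t) (poly b1 t) (poly b2 t) (poly c t) (poly d1 t) (poly d2 t) x y"
        by (auto simp: trivial_common_kernel_def)
      let ?x = "\<lambda>j. x * t ^ j" and ?y = "\<lambda>j. y * t ^ j" and ?l = "[:-t, 1:]"
      have comb: "?l * (shift_comb k p ?x + shift_comb k q ?y) = p * [:x:] + q * [:y:]"
        if "degree p \<le> k" "degree q \<le> k" "poly p t * x + poly q t * y = 0" for p q
      proof -
        have "smult x [:poly p t:] + smult y [:poly q t:] = 0"
          using that(3) by (simp add: mult.commute)
        moreover have "?l * (shift_comb k p ?x + shift_comb k q ?y)
            = smult x p + smult y q - (smult x [:poly p t:] + smult y [:poly q t:])"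
          unfolding ring_distribs shift_comb_power[OF that(1)] shift_comb_power[OF that(2)]
          by (simp only: smult_diff_right algebra_simps)
        ultimately show ?thesis by simp
      qed
      \<comment> \<open>The kernel vector removes the constant of the divided difference, leaving
        \<open>(X - t) U = P v\<close> and \<open>(X - t) V = Q v\<close> for the constant vector
        \<open>v = (x, y)\<close>.\<close>
      have UV: "?l * U1 ?x ?y = a * [:x:] + b1 * [:y:]" "?l * U2 ?x ?y = b2 * [:x:] + a * [:y:]"
        "?l * V1 ?x ?y = c * [:x:] + d1 * [:y:]" "?l * V2 ?x ?y = d2 * [:x:] + c * [:y:]"
        unfolding UV_def using deg ker by (simp_all only: comb common_kernel_def)
      \<comment> \<open>This is \<open>P Q = Q P\<close> on the vector \<open>(r, s)\<close>; with
        \<open>UV\<close> it gives the syzygy after cancelling \<open>?l\<close>.\<close>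
      have act: "a * (c * r + d1 * s) + b1 * (d2 * r + c * s)
          = c * (a * r + b1 * s) + d1 * (b2 * r + a * s)"
        "b2 * (c * r + d1 * s) + a * (d2 * r + c * s)
          = d2 * (a * r + b1 * s) + c * (b2 * r + a * s)" for r s
      proof -
        have "a * (c * r + d1 * s) + b1 * (d2 * r + c * s)
            = c * (a * r + b1 * s) + d1 * (b2 * r + a * s) + (b1 * d2 - d1 * b2) * r"
          "b2 * (c * r + d1 * s) + a * (d2 * r + c * s)
            = d2 * (a * r + b1 * s) + c * (b2 * r + a * s) + (d1 * b2 - b1 * d2) * s"
          by (simp_all only: ring_distribs) (simp_all add: ac_simps)
        then show "a * (c * r + d1 * s) + b1 * (d2 * r + c * s)
            = c * (a * r + b1 * s) + d1 * (b2 * r + a * s)"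
          "b2 * (c * r + d1 * s) + a * (d2 * r + c * s)
            = d2 * (a * r + b1 * s) + c * (b2 * r + a * s)"
          by (simp_all only: comm diff_self mult_zero_left add_0_right)
      qed
      have "?l * (a * V1 ?x ?y + b1 * V2 ?x ?y) = a * (?l * V1 ?x ?y) + b1 * (?l * V2 ?x ?y)"
        by (simp only: ac_simps distrib_left)
      also have "\<dots> = c * (?l * U1 ?x ?y) + d1 * (?l * U2 ?x ?y)"
        unfolding UV by (rule act)
      also have "\<dots> = ?l * (c * U1 ?x ?y + d1 * U2 ?x ?y)"
        by (simp only: ac_simps distrib_left)
      finally have syz1: "?l * (a * V1 ?x ?y + b1 * V2 ?x ?y) = ?l * (c * U1 ?x ?y + d1 * U2 ?x ?y)" .
      have "?l * (b2 * V1 ?x ?y + a * V2 ?x ?y) = b2 * (?l * V1 ?x ?y) + a * (?l * V2 ?x ?y)"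
        by (simp only: ac_simps distrib_left)
      also have "\<dots> = d2 * (?l * U1 ?x ?y) + c * (?l * U2 ?x ?y)"
        unfolding UV by (rule act)
      also have "\<dots> = ?l * (d2 * U1 ?x ?y + c * U2 ?x ?y)"
        by (simp only: ac_simps distrib_left)
      finally have syz2: "?l * (b2 * V1 ?x ?y + a * V2 ?x ?y) = ?l * (d2 * U1 ?x ?y + c * U2 ?x ?y)" .
      have "?l \<noteq> 0" by simp
      with syz1 syz2 have "syz ?x ?y"
        unfolding syz_def mult_cancel_left by blast
      \<comment> \<open>The entries at index 0 are \<open>x\<close> and \<open>y\<close>, even for
        \<open>t = 0\<close>.\<close>
      then show "\<exists>x y. (\<exists>j<k. x j \<noteq> 0 \<or> y j \<noteq> 0) \<and> syz x y"
        using nz k by (intro exI[of _ ?x] exI[of _ ?y]) auto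
    next
      assume "\<not> ?inf"
      then obtain x y where nz: "x \<noteq> 0 \<or> y \<noteq> 0" and
        ker: "common_kernel (coeff a k) (coeff b1 k) (coeff b2 k) (coeff c k) (coeff d1 k) (coeff d2 k) x y"
        by (auto simp: trivial_common_kernel_def)
      \<comment> \<open>For \<open>degree p \<le> k\<close>, \<open>poly_shift k p\<close> is the
        constant \<open>coeff p k\<close>. Weight on the last index alone thus turns
        \<open>U\<close> and \<open>V\<close> into the leading matrices applied to
        \<open>(x, y)\<close>.\<close>
      let ?x = "\<lambda>j. if j = k - 1 then x else 0" and ?y = "\<lambda>j. if j = k - 1 then y else 0"
      have "shift_comb k p ?x = [:x * coeff p k:]" "shift_comb k p ?y = [:y * coeff p k:]"
        if "degree p \<le> k" for p
        using that k
        by (auto simp: poly_eq_iff coeff_shift_comb coeff_pCons coeff_eq_0 if_distrib[of "\<lambda>z. z * _"]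
            cong: if_cong split: nat.splits)
      then have "U1 ?x ?y = 0" "U2 ?x ?y = 0" "V1 ?x ?y = 0" "V2 ?x ?y = 0"
        using deg ker by (simp_all add: UV_def common_kernel_def mult.commute)
      then have "syz ?x ?y" by (simp add: syz_def)
      then show "\<exists>x y. (\<exists>j<k. x j \<noteq> 0 \<or> y j \<noteq> 0) \<and> syz x y"
        using nz k by (intro exI[of _ ?x] exI[of _ ?y] conjI exI[of _ "k - 1"]) auto
    qed
  qed
qed


section \<open>Points of the curve\<close>

lemma section_vanishes_at_class_iff:
  assumes "b = 0 \<or> g + 1 \<le> k" and "v \<in> curve_cone g f"
  shows "section_vanishes_at g k a b (weighted_rel g f `` {v}) \<longleftrightarrow> section_form g k a b v = 0"
proof
  assume "section_vanishes_at g k a b (weighted_rel g f `` {v})"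
  moreover have "v \<in> weighted_rel g f `` {v}"
    using equiv_weighted_rel assms(2) by (rule equiv_class_self)
  ultimately show "section_form g k a b v = 0"
    by (simp add: section_vanishes_at_def)
next
  assume "section_form g k a b v = 0"
  then show "section_vanishes_at g k a b (weighted_rel g f `` {v})"
    using section_form_scale[OF assms(1)]
    by (cases v) (auto simp: section_vanishes_at_def weighted_rel_def simp del: power_Suc)
qed

text \<open>Forms of weighted degree \<open>k\<close> may be tested on one representative of a
  point, scaled to \<open>x0 = 1\<close>, or to \<open>x1 = 1\<close> if
  \<open>x0 = 0\<close>.\<close>

lemma common_zero_iff_affine_or_infinity:
  fixes f a b c d :: "'a::field poly"
  assumes f: "degree f \<le> 2 * g + 2" and ac: "degree a \<le> k" "degree c \<le> k"
    and b: "b = 0 \<or> g + 1 + degree b \<le> k" and d: "d = 0 \<or> g + 1 + degree d \<le> k"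
  shows "(\<exists>P\<in>hyperelliptic_curve g f. section_vanishes_at g k a b P \<and> section_vanishes_at g k c d P)
    \<longleftrightarrow> (\<exists>t y. y\<^sup>2 = poly f t \<and> poly a t + poly b t * y = 0 \<and> poly c t + poly d t * y = 0) \<or>
        (\<exists>y. y\<^sup>2 = coeff f (2 * g + 2) \<and> coeff a k + coeff b (k - (g + 1)) * y = 0 \<and>
           coeff c k + coeff d (k - (g + 1)) * y = 0)"
    (is "_ \<longleftrightarrow> ?aff \<or> ?inf")
proof -
  \<comment> \<open>If \<open>k < g + 1\<close>, the subtraction truncates to 0, which is harmless
    because \<open>b\<close> and \<open>d\<close> are then zero.\<close>
  have bd: "b = 0 \<or> g + 1 \<le> k" "d = 0 \<or> g + 1 \<le> k"
    "degree b \<le> k - (g + 1)" "degree d \<le> k - (g + 1)"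
    using b d by auto
  define Z where "Z v \<longleftrightarrow> v \<in> curve_cone g f \<and> section_form g k a b v = 0 \<and> section_form g k c d v = 0"
    for v
  have "(\<exists>P\<in>hyperelliptic_curve g f. section_vanishes_at g k a b P \<and> section_vanishes_at g k c d P)
      \<longleftrightarrow> (\<exists>v. Z v)"
  proof -
    have "hyperelliptic_curve g f = (\<lambda>v. weighted_rel g f `` {v}) ` curve_cone g f"
      by (auto simp: hyperelliptic_curve_def quotient_def)
    then show ?thesis
      using section_vanishes_at_class_iff[OF bd(1)] section_vanishes_at_class_iff[OF bd(2)]
      by (auto simp: Z_def)
  qed
  also have "\<dots> \<longleftrightarrow> (\<exists>t y. Z (1, t, y)) \<or> (\<exists>y. Z (0, 1, y))"
  proof
    assume "\<exists>v. Z v"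
    then obtain x0 x1 y where Z: "Z (x0, x1, y)" by auto
    have scale: "Z (l * x0, l * x1, l ^ (g + 1) * y)" if "l \<noteq> 0" for l
    proof -
      have "((x0, x1, y), (l * x0, l * x1, l ^ (g + 1) * y)) \<in> weighted_rel g f"
        using Z that by (auto simp: weighted_rel_def Z_def)
      then have "(l * x0, l * x1, l ^ (g + 1) * y) \<in> curve_cone g f"
        using equiv_weighted_rel[of g f] by (auto simp: equiv_def)
      then show ?thesis
        using Z unfolding Z_def section_form_scale[OF bd(1)] section_form_scale[OF bd(2)] by simp
    qed
    show "(\<exists>t y. Z (1, t, y)) \<or> (\<exists>y. Z (0, 1, y))"
    proof (cases "x0 = 0")
      case True
      then have "x1 \<noteq> 0" using Z by (auto simp: Z_def curve_cone_def)
      then show ?thesis using scale[of "inverse x1"] True by auto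
    next
      case False
      then show ?thesis using scale[of "inverse x0"] by auto
    qed
  qed auto
  also have "\<dots> \<longleftrightarrow> ?aff \<or> ?inf"
    using f ac bd(3,4)
    by (simp add: Z_def curve_cone_def section_form_def homogenize_one homogenize_infinity)
  finally show ?thesis .
qed

section \<open>Passage to the algebraic closure\<close>

lemma map_poly_to_ac_mult:
  "map_poly to_ac (p * q) = map_poly to_ac p * map_poly to_ac (q :: 'a::field poly)"
  by (simp add: poly_eq_iff coeff_map_poly coeff_mult to_ac_sum)

lemma degree_map_poly_to_ac: "degree (map_poly to_ac p) = degree (p :: 'a::field poly)"
  by (rule degree_map_poly) simp

lemma map_poly_to_ac_eq_0_iff: "map_poly to_ac p = 0 \<longleftrightarrow> (p :: 'a::field poly) = 0"
  by (simp add: poly_eq_iff coeff_map_poly)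

lemma to_ac_sum_lt: "to_ac (sum_lt k i j h) = sum_lt k i j (\<lambda>p q. to_ac (h p q))"
  by (simp add: sum_lt_def to_ac_sum case_prod_unfold)

lemma to_ac_sum_all: "to_ac (sum_all k i j h) = sum_all k i j (\<lambda>p q. to_ac (h p q))"
  by (simp add: sum_all_def to_ac_sum case_prod_unfold)

lemma to_ac_minor2:
  "to_ac (minor2 (col2 r s p) (col2 r' s' q)) =
    minor2 (col2 (map_poly to_ac r) (map_poly to_ac s) p) (col2 (map_poly to_ac r') (map_poly to_ac s') q)"
  by (simp add: minor2_def col2_def coeff_map_poly)

lemma map_mat_resultant_matrix:
  fixes f1 f2 a b c d :: "'a::field poly"
  shows "map_mat to_ac (resultant_matrix k f1 f2 a b c d) =
    resultant_matrix k (map_poly to_ac f1) (map_poly to_ac f2) (map_poly to_ac a) (map_poly to_ac b)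
      (map_poly to_ac c) (map_poly to_ac d)"
  unfolding resultant_matrix_def Let_def map_poly_to_ac_mult[symmetric]
  by (rule eq_matI)
    (auto simp: mat_from_1_def to_ac_sum_lt to_ac_sum_all to_ac_minor2)

lemma det_resultant_matrix_to_ac:
  fixes f1 f2 a b c d :: "'a::field poly"
  shows "det (resultant_matrix k (map_poly to_ac f1) (map_poly to_ac f2) (map_poly to_ac a)
      (map_poly to_ac b) (map_poly to_ac c) (map_poly to_ac d)) = to_ac (det (resultant_matrix k f1 f2 a b c d))"
proof -
  interpret comm_ring_hom "to_ac :: 'a \<Rightarrow> 'a alg_closure"
    by unfold_locales auto
  show ?thesis by (simp flip: map_mat_resultant_matrix)
qed

text \<open>At a root of \<open>f\<close>, necessarily simple, \<open>a\<^sup>2\<close> has even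
  order and \<open>b\<^sup>2 * f\<close> odd order. So a nonzero \<open>a + b sqrt f\<close> has
  nonzero norm.\<close>

lemma square_neq_square_mult_rsquarefree:
  fixes f :: "'a::alg_closed_field poly"
  assumes "rsquarefree f" "degree f > 0" "a \<noteq> 0 \<or> b \<noteq> 0"
  shows "a\<^sup>2 \<noteq> b\<^sup>2 * f"
proof
  assume eq: "a\<^sup>2 = b\<^sup>2 * f"
  have "f \<noteq> 0" using assms(2) by auto
  with eq assms(3) have nz: "a * a \<noteq> 0" "b * b * f \<noteq> 0" "b * b \<noteq> 0"
    by (auto simp: power2_eq_square)
  obtain t where "poly f t = 0"
    using alg_closed_imp_poly_has_root[OF assms(2)] by blast
  then have "order t f = 1"
    using assms(1) \<open>f \<noteq> 0\<close> by (metis order_root rsquarefree_def)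
  then have "order t a + order t a = order t b + order t b + 1"
    using arg_cong[OF eq, of "order t"] order_mult[OF nz(1)] order_mult[OF nz(2)] order_mult[OF nz(3)]
    by (simp add: power2_eq_square)
  then show False by presburger
qed

theorem proposition4p7:
  fixes f f1 f2 a b c d :: "'a::field poly" and g k :: nat
  assumes "CHAR('a) \<noteq> 2"
    and "degree f = 2 * g + 2"
    and "rsquarefree (map_poly to_ac f)"
    and "f = f1 * f2" and "degree f1 = g + 1" and "degree f2 = g + 1"
    and "\<not> (a = 0 \<and> b = 0 \<and> c = 0 \<and> d = 0)"
    and "k = Max ({degree p |p. p \<in> {a, c} \<and> p \<noteq> 0} \<union>
                  {g + 1 + degree p |p. p \<in> {b, d} \<and> p \<noteq> 0})"
    and "k \<le> 12"
  shows "have_common_zero g f k a b c d \<longleftrightarrow> det (resultant_matrix k f1 f2 a b c d) = 0"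
proof -
  let ?M = "{degree p |p. p \<in> {a, c} \<and> p \<noteq> 0} \<union> {g + 1 + degree p |p. p \<in> {b, d} \<and> p \<noteq> 0}"
  have "finite ?M" by auto
  then have "m \<le> k" if "m \<in> ?M" for m
    using that assms(8) by auto
  \<comment> \<open>The maximum skips zero polynomials. Their library degree 0 satisfies the bounds
    for \<open>a\<close> and \<open>c\<close>, whereas \<open>b\<close> and \<open>d\<close> need a
    separate case.\<close>
  then have deg: "degree a \<le> k" "degree c \<le> k" "b = 0 \<or> g + 1 + degree b \<le> k"
    "d = 0 \<or> g + 1 + degree d \<le> k"
    by (cases "a = 0"; cases "c = 0"; force)+
  let ?h = "map_poly to_ac"
  define F F1 F2 A B C D where "F = ?h f" and "F1 = ?h f1" and "F2 = ?h f2"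
    and "A = ?h a" and "B = ?h b" and "C = ?h c" and "D = ?h d"
  note defs = this
  have F: "F = F1 * F2" "degree F = 2 * g + 2" "degree F1 = g + 1" "degree F2 = g + 1"
    using assms(2,5,6) unfolding defs degree_map_poly_to_ac
    by (simp_all only: assms(4) map_poly_to_ac_mult)
  have degs: "degree A \<le> k" "degree C \<le> k" "B = 0 \<or> g + 1 + degree B \<le> k"
    "D = 0 \<or> g + 1 + degree D \<le> k"
    using deg by (simp_all add: defs degree_map_poly_to_ac map_poly_to_ac_eq_0_iff)
  \<comment> \<open>This identifies the leading matrices: degree \<open>k\<close> of
    \<open>b * f1\<close> involves only the leading coefficient of \<open>f1\<close>.\<close>
  have prod: "degree (p * q) \<le> k" "coeff (p * q) k = coeff p (k - (g + 1)) * coeff q (g + 1)"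
    if "p = 0 \<or> g + 1 + degree p \<le> k" "degree q = g + 1" for p q :: "'a alg_closure poly"
  proof -
    show "degree (p * q) \<le> k"
      using that degree_mult_le[of p q] by auto
    show "coeff (p * q) k = coeff p (k - (g + 1)) * coeff q (g + 1)"
    proof (cases "p = 0")
      case False
      then have "k = k - (g + 1) + (g + 1)" using that by auto
      then show ?thesis
        using coeff_mult_top[of p "k - (g + 1)" q "g + 1"] that by auto
    qed simp
  qed
  have "A\<^sup>2 \<noteq> B\<^sup>2 * F \<or> C\<^sup>2 \<noteq> D\<^sup>2 * F"
    using square_neq_square_mult_rsquarefree[of F A B] square_neq_square_mult_rsquarefree[of F C D]
      assms(3,7) F(2) by (auto simp: defs map_poly_to_ac_eq_0_iff)
  then have det: "A\<^sup>2 \<noteq> (B * F1) * (B * F2) \<or> C\<^sup>2 \<noteq> (D * F1) * (D * F2)"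
    by (simp add: F(1) power2_eq_square ac_simps)
  have top: "coeff F (2 * g + 2) = coeff F1 (g + 1) * coeff F2 (g + 1)"
    using coeff_mult_top[of F1 "g + 1" F2 "g + 1"] F by (simp add: mult_2)
  have "have_common_zero g f k a b c d \<longleftrightarrow>
      (\<exists>t y. y\<^sup>2 = poly F t \<and> poly A t + poly B t * y = 0 \<and> poly C t + poly D t * y = 0) \<or>
      (\<exists>y. y\<^sup>2 = coeff F (2 * g + 2) \<and> coeff A k + coeff B (k - (g + 1)) * y = 0 \<and>
         coeff C k + coeff D (k - (g + 1)) * y = 0)"
    unfolding have_common_zero_def defs[symmetric]
    by (rule common_zero_iff_affine_or_infinity) (use F degs in auto)
  \<comment> \<open>\<open>nontrivial_common_kernel_iff\<close> is applied to the values of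
    \<open>F1\<close> and \<open>F2\<close> at \<open>t\<close>, and at infinity to their leading
    coefficients, whose product is that of \<open>F\<close> by \<open>top\<close>.\<close>
  also have "\<dots> \<longleftrightarrow> det (resultant_matrix k F1 F2 A B C D) = 0"
    using degs F(3,4) det
    by (simp only: det_resultant_matrix_eq_0_iff prod poly_mult nontrivial_common_kernel_iff
        top[unfolded F(1)] F(1))
  also have "\<dots> \<longleftrightarrow> det (resultant_matrix k f1 f2 a b c d) = 0"
    unfolding defs det_resultant_matrix_to_ac by simp
  finally show ?thesis .
qed

end
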